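(* Let $X$ be a finitely supported subset of an invariant set. (1) If $X$ is not FSM uniformly infinite, then every finitely supported injective function $f:X\to X$ is surjective. (2) If $\wp_{fs}(X)$ is not FSM uniformly infinite, then every finitely supported surjective function $f:X\to X$ is injective. Moreover, the converse of this implication fails: every finitely supported surjective function $f:\wp_{fin}(A)\to\wp_{fin}(A)$ is injective, while $\wp_{fs}(\wp_{fin}(A))$ is FSM uniformly infinite.
   Context: Fix an infinite set $A$ of atoms. $S_A$ is the group of bijections of $A$ that are compositions of finitely many transpositions; it acts on $A$ by $\pi\cdot a=\pi(a)$. An $S_A$-set is a set with a group action $\cdot$ of $S_A$. For $S\subseteq A$, $Fix(S)=\{\pi\in S_A:\pi(a)=a\ \forall a\in S\}$; $S$ supports $x$ if $\pi\cdot x=x$ for all $\pi\in Fix(S)$; the least finite supporting set of $x$ is $supp(x)$. An invariant set is an $S_A$-set all of whose elements have finite supporting sets. Powersets carry $\pi\star Z=\{\pi\cdot z:z\in Z\}$; $\wp_{fs}(Y)$ is the set of subsets of $Y$ finitely supported under $\star$, whose elements are called finitely supported subsets of $Y$; for $X\in\wp_{fs}(Y)$, $\wp_{fs}(X)=\{Z\in\wp_{fs}(Y):Z\subseteq X\}$ (a finitely supported subset of the invariant set $\wp_{fs}(Y)$). $\wp_{fin}(A)$ is the set of finite subsets of $A$. A function $f:Z\to T$ between finitely supported subsets of invariant sets $U,V$ is finitely supported if its graph is a finitely supported subset of $U\times V$ (componentwise action); equivalently some finite $S$ satisfies $f(\pi\cdot x)=\pi\cdot f(x)$ for all $\pi\in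 Fix(S)$, $x\in Z$. A set is uniformly supported if one finite $S\subseteq A$ supports all its elements. A finitely supported subset of an invariant set is FSM uniformly infinite if it contains an infinite uniformly supported subset. *)

theory Defs
  imports
    "HOL-Algebra.Group_Action"
    "HOL-Combinatorics.Permutations"
    "HOL-Library.Infinite_Typeclass"
begin

text \<open>
  The atoms are the elements of a type \<^typ>\<open>'a\<close>, which is of class \<^class>\<open>infinite\<close> where
  infinitude matters. In the library, \<^term>\<open>permutation \<pi>\<close> means that \<open>\<pi>\<close> is a composition of
  finitely many transpositions.
\<close>

definition atom_perms :: "('a \<Rightarrow> 'a) monoid" where
  "atom_perms = \<lparr>carrier = {\<pi>. permutation \<pi>}, monoid.mult = (\<circ>), one = id\<rparr>"

definition Fix :: "'a set \<Rightarrow> ('a \<Rightarrow> 'a) set" where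
  "Fix S = {\<pi>. permutation \<pi> \<and> (\<forall>a\<in>S. \<pi> a = a)}"

definition supports :: "(('a \<Rightarrow> 'a) \<Rightarrow> 'x \<Rightarrow> 'x) \<Rightarrow> 'a set \<Rightarrow> 'x \<Rightarrow> bool" where
  "supports act S x \<longleftrightarrow> (\<forall>\<pi>\<in>Fix S. act \<pi> x = x)"

definition finitely_supported :: "(('a \<Rightarrow> 'a) \<Rightarrow> 'x \<Rightarrow> 'x) \<Rightarrow> 'x \<Rightarrow> bool" where
  "finitely_supported act x \<longleftrightarrow> (\<exists>S. finite S \<and> supports act S x)"

text \<open>
  Library group actions are extensional, i.e. fixed to be \<^const>\<open>undefined\<close> outside the carrier. The
  restriction makes this hold for any \<open>act\<close>, whose values outside \<open>Y\<close> are thus irrelevant;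
  the power set and product actions can then be written without restrictions.
\<close>

definition perm_set :: "'x set \<Rightarrow> (('a \<Rightarrow> 'a) \<Rightarrow> 'x \<Rightarrow> 'x) \<Rightarrow> bool" where
  "perm_set Y act \<longleftrightarrow> group_action atom_perms Y (\<lambda>\<pi>. restrict (act \<pi>) Y)"

definition invariant_set :: "'x set \<Rightarrow> (('a \<Rightarrow> 'a) \<Rightarrow> 'x \<Rightarrow> 'x) \<Rightarrow> bool" where
  "invariant_set Y act \<longleftrightarrow> perm_set Y act \<and> (\<forall>y\<in>Y. finitely_supported act y)"

definition atom_act :: "('a \<Rightarrow> 'a) \<Rightarrow> 'a \<Rightarrow> 'a" where
  "atom_act \<pi> a = \<pi> a"

definition star :: "(('a \<Rightarrow> 'a) \<Rightarrow> 'x \<Rightarrow> 'x) \<Rightarrow> ('a \<Rightarrow> 'a) \<Rightarrow> 'x set \<Rightarrow> 'x set" where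
  "star act \<pi> Z = act \<pi> ` Z"

definition prod_act ::
    "(('a \<Rightarrow> 'a) \<Rightarrow> 'x \<Rightarrow> 'x) \<Rightarrow> (('a \<Rightarrow> 'a) \<Rightarrow> 'y \<Rightarrow> 'y) \<Rightarrow> ('a \<Rightarrow> 'a) \<Rightarrow> 'x \<times> 'y \<Rightarrow> 'x \<times> 'y" where
  "prod_act actX actY \<pi> = map_prod (actX \<pi>) (actY \<pi>)"

text \<open>
  The same formula gives both the finitely supported power set of an invariant set and that
  of a finitely supported subset \<open>X\<close> of an invariant set \<open>Y\<close>; see \<open>fs_pow_subset\<close> below.
\<close>

definition fs_pow :: "(('a \<Rightarrow> 'a) \<Rightarrow> 'x \<Rightarrow> 'x) \<Rightarrow> 'x set \<Rightarrow> 'x set set" where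
  "fs_pow act X = {Z. Z \<subseteq> X \<and> finitely_supported (star act) Z}"

definition fs_fun ::
    "(('a \<Rightarrow> 'a) \<Rightarrow> 'x \<Rightarrow> 'x) \<Rightarrow> (('a \<Rightarrow> 'a) \<Rightarrow> 'y \<Rightarrow> 'y) \<Rightarrow> 'x set \<Rightarrow> 'y set \<Rightarrow> ('x \<Rightarrow> 'y) \<Rightarrow> bool" where
  "fs_fun actX actY Z T f \<longleftrightarrow>
     f \<in> Z \<rightarrow> T \<and> finitely_supported (star (prod_act actX actY)) ((\<lambda>x. (x, f x)) ` Z)"

definition uniformly_supported :: "(('a \<Rightarrow> 'a) \<Rightarrow> 'x \<Rightarrow> 'x) \<Rightarrow> 'x set \<Rightarrow> bool" where
  "uniformly_supported act Z \<longleftrightarrow> (\<exists>S. finite S \<and> (\<forall>z\<in>Z. supports act S z))"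

definition uniformly_infinite :: "(('a \<Rightarrow> 'a) \<Rightarrow> 'x \<Rightarrow> 'x) \<Rightarrow> 'x set \<Rightarrow> bool" where
  "uniformly_infinite act X \<longleftrightarrow> (\<exists>Z\<subseteq>X. infinite Z \<and> uniformly_supported act Z)"

definition fin_pow :: "'a set set" where
  "fin_pow = {Z. finite Z}"

lemma permutation_inverse_obtain:
  assumes "permutation \<pi>"
  obtains \<rho> where "permutation \<rho>" "\<rho> \<circ> \<pi> = id" "\<pi> \<circ> \<rho> = id"
  using permutation_inverse[OF assms] permutation_inverse_works[OF assms] by blast

lemma group_atom_perms: "group atom_perms"
proof (rule groupI)
  fix \<pi> :: "'a \<Rightarrow> 'a" assume "\<pi> \<in> carrier atom_perms"
  then obtain \<rho> where "permutation \<rho>" "\<rho> \<circ> \<pi> = id"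
    by (auto simp: atom_perms_def elim: permutation_inverse_obtain)
  then show "\<exists>\<sigma>\<in>carrier atom_perms. \<sigma> \<otimes>\<^bsub>atom_perms\<^esub> \<pi> = \<one>\<^bsub>atom_perms\<^esub>"
    by (auto simp: atom_perms_def)
qed (auto simp: atom_perms_def permutation_compose permutation_id comp_assoc)

lemma perm_set_iff:
  "perm_set Y act \<longleftrightarrow>
     (\<forall>\<pi>. permutation \<pi> \<longrightarrow> act \<pi> ` Y \<subseteq> Y) \<and> (\<forall>y\<in>Y. act id y = y) \<and>
     (\<forall>\<pi> \<sigma>. permutation \<pi> \<longrightarrow> permutation \<sigma> \<longrightarrow> (\<forall>y\<in>Y. act (\<pi> \<circ> \<sigma>) y = act \<pi> (act \<sigma> y)))"
  (is "_ \<longleftrightarrow> ?R")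
proof
  assume "perm_set Y act"
  then interpret group_action atom_perms Y "\<lambda>\<pi>. restrict (act \<pi>) Y"
    by (simp add: perm_set_def)
  have closed: "act \<pi> y \<in> Y" if "permutation \<pi>" "y \<in> Y" for \<pi> y
    using element_image[of \<pi> y] that by (simp add: atom_perms_def)
  have "act id y = y" if "y \<in> Y" for y
    using fun_cong[OF id_eq_one, of y] that by (simp add: atom_perms_def)
  moreover have "act (\<pi> \<circ> \<sigma>) y = act \<pi> (act \<sigma> y)"
    if "permutation \<pi>" "permutation \<sigma>" "y \<in> Y" for \<pi> \<sigma> y
    using composition_rule[of y \<pi> \<sigma>] that closed by (simp add: atom_perms_def)
  ultimately show ?R using closed by auto
next
  assume R: ?R
  have bij: "restrict (act \<pi>) Y \<in> Bij Y" if \<pi>: "permutation \<pi>" for \<pi>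
  proof -
    obtain \<rho> where i: "permutation \<rho>" "\<rho> \<circ> \<pi> = id" "\<pi> \<circ> \<rho> = id"
      using \<pi> by (rule permutation_inverse_obtain)
    then have "act \<rho> (act \<pi> y) = y" "act \<pi> (act \<rho> y) = y" if "y \<in> Y" for y
      using R \<pi> that by metis+
    then have "bij_betw (act \<pi>) Y Y"
      by (intro bij_betw_byWitness[where f' = "act \<rho>"]) (use R \<pi> i in auto)
    then show ?thesis by (simp add: Bij_def)
  qed
  have "(\<lambda>\<pi>. restrict (act \<pi>) Y) \<in> hom atom_perms (BijGroup Y)"
  proof (rule homI)
    fix \<pi> \<sigma> :: "'b \<Rightarrow> 'b"
    assume "\<pi> \<in> carrier atom_perms" "\<sigma> \<in> carrier atom_perms"
    then show "restrict (act (\<pi> \<otimes>\<^bsub>atom_perms\<^esub> \<sigma>)) Y =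
        restrict (act \<pi>) Y \<otimes>\<^bsub>BijGroup Y\<^esub> restrict (act \<sigma>) Y"
      using R bij by (auto simp: atom_perms_def BijGroup_def compose_def fun_eq_iff image_subset_iff)
  qed (use bij in \<open>auto simp: atom_perms_def BijGroup_def\<close>)
  then show "perm_set Y act"
    unfolding perm_set_def group_action_def group_hom_def group_hom_axioms_def
    by (simp add: group_atom_perms group_BijGroup)
qed

lemma finitely_supported_act:
  assumes Y: "perm_set Y act" and "y \<in> Y" "finitely_supported act y" and \<pi>: "permutation \<pi>"
  shows "finitely_supported act (act \<pi> y)"
proof -
  note R = Y[unfolded perm_set_iff]
  obtain S where S: "finite S" "supports act S y"
    using assms by (auto simp: finitely_supported_def)
  obtain \<rho> where i: "permutation \<rho>" "\<rho> \<circ> \<pi> = id" "\<pi> \<circ> \<rho> = id"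
    using \<pi> by (rule permutation_inverse_obtain)
  have "act \<sigma> (act \<pi> y) = act \<pi> y" if "\<sigma> \<in> Fix (\<pi> ` S)" for \<sigma>
  proof -
    have \<sigma>: "permutation \<sigma>" "\<forall>a\<in>S. \<sigma> (\<pi> a) = \<pi> a"
      using that by (auto simp: Fix_def)
    let ?\<tau> = "\<rho> \<circ> \<sigma> \<circ> \<pi>"
    have p: "permutation ?\<tau>" using \<sigma> \<pi> i by (auto intro: permutation_compose)
    then have "?\<tau> \<in> Fix S" using \<sigma> i(2) by (auto simp: Fix_def fun_eq_iff)
    then have "act ?\<tau> y = y" using S by (auto simp: supports_def)
    moreover have "\<sigma> \<circ> \<pi> = \<pi> \<circ> ?\<tau>" using i(3) by (auto simp: fun_eq_iff)
    moreover have "act (\<sigma> \<circ> \<pi>) y = act \<sigma> (act \<pi> y)" "act (\<pi> \<circ> ?\<tau>) y = act \<pi> (act ?\<tau> y)"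
      using R \<sigma> \<pi> p \<open>y \<in> Y\<close> by blast+
    ultimately show ?thesis by simp
  qed
  then show ?thesis using S(1) by (auto simp: finitely_supported_def supports_def)
qed

lemma perm_set_Pow:
  assumes "perm_set Y act"
  shows "perm_set (Pow Y) (star act)"
proof -
  note R = assms[unfolded perm_set_iff]
  have "act id ` Z = Z" if "Z \<subseteq> Y" for Z
    using R that by (force simp: image_def)
  moreover have "act \<pi> ` Z \<subseteq> Y" if "permutation \<pi>" "Z \<subseteq> Y" for \<pi> Z
    using R that by blast
  moreover have "act (\<pi> \<circ> \<sigma>) ` Z = act \<pi> ` act \<sigma> ` Z"
    if "permutation \<pi>" "permutation \<sigma>" "Z \<subseteq> Y" for \<pi> \<sigma> Z
    unfolding image_image by (rule image_cong[OF refl]) (use R that in blast)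
  ultimately show ?thesis
    unfolding perm_set_iff star_def by (simp add: image_subset_iff)
qed

lemma invariant_set_fs_pow:
  assumes "invariant_set Y act"
  shows "invariant_set (fs_pow act Y) (star act)"
proof -
  have P: "perm_set (Pow Y) (star act)"
    using assms by (simp add: invariant_set_def perm_set_Pow)
  then have "star act \<pi> Z \<in> fs_pow act Y" if "permutation \<pi>" "Z \<in> fs_pow act Y" for \<pi> Z
    using finitely_supported_act[OF P, of Z \<pi>] that P[unfolded perm_set_iff]
    by (auto simp: fs_pow_def)
  then show ?thesis
    using P unfolding invariant_set_def perm_set_iff by (auto simp: fs_pow_def)
qed

lemma fs_pow_subset:
  assumes "X \<in> fs_pow act Y"
  shows "fs_pow act X = {Z \<in> fs_pow act Y. Z \<subseteq> X}"
  using assms by (auto simp: fs_pow_def)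

lemma fs_pow_in_fs_pow:
  assumes Y: "invariant_set Y act" and X: "X \<in> fs_pow act Y"
  shows "fs_pow act X \<in> fs_pow (star act) (fs_pow act Y)"
proof -
  note F = invariant_set_fs_pow[OF Y, unfolded invariant_set_def, THEN conjunct1, unfolded perm_set_iff]
  have PY: "fs_pow act X \<subseteq> fs_pow act Y" using X by (auto simp: fs_pow_def)
  obtain S where S: "finite S" "supports (star act) S X"
    using X by (auto simp: fs_pow_def finitely_supported_def)
  have sub: "star act \<pi> Z \<in> fs_pow act X" if \<pi>: "\<pi> \<in> Fix S" and Z: "Z \<in> fs_pow act X" for \<pi> Z
  proof -
    have "act \<pi> ` X = X" using S \<pi> by (auto simp: supports_def star_def)
    then have "star act \<pi> Z \<subseteq> X" using Z by (auto simp: fs_pow_def star_def)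
    moreover have "star act \<pi> Z \<in> fs_pow act Y"
      using F \<pi> Z PY by (auto simp: Fix_def)
    ultimately show ?thesis by (simp add: fs_pow_def)
  qed
  have "star (star act) \<pi> (fs_pow act X) = fs_pow act X" if \<pi>: "\<pi> \<in> Fix S" for \<pi>
  proof
    show "star (star act) \<pi> (fs_pow act X) \<subseteq> fs_pow act X"
      using sub[OF \<pi>] by (auto simp: star_def[of "star act"])
  next
    have p: "permutation \<pi>" using \<pi> by (simp add: Fix_def)
    then obtain \<rho> where i: "permutation \<rho>" "\<rho> \<circ> \<pi> = id" "\<pi> \<circ> \<rho> = id"
      by (rule permutation_inverse_obtain)
    have "\<rho> a = a" if "a \<in> S" for a
      using that \<pi> fun_cong[OF i(2), of a] by (auto simp: Fix_def)
    then have "\<rho> \<in> Fix S" using i(1) by (simp add: Fix_def)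
    show "fs_pow act X \<subseteq> star (star act) \<pi> (fs_pow act X)"
    proof
      fix Z assume Z: "Z \<in> fs_pow act X"
      have "star act \<pi> (star act \<rho> Z) = star act (\<pi> \<circ> \<rho>) Z"
        using F p i(1) Z PY by (metis subsetD)
      also have "\<dots> = Z" using F i(3) Z PY by (metis subsetD)
      finally show "Z \<in> star (star act) \<pi> (fs_pow act X)"
        using sub[OF \<open>\<rho> \<in> Fix S\<close> Z] unfolding star_def[of "star act"] by (metis image_eqI)
    qed
  qed
  then show ?thesis
    using S(1) PY unfolding fs_pow_def[of "star act"] finitely_supported_def supports_def by blast
qed

lemma invariant_set_fin_pow: "invariant_set fin_pow (star atom_act)"
proof -
  have "finitely_supported (star atom_act) Z" if "finite Z" for Z :: "'a set"
    unfolding finitely_supported_def supports_def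
    by (rule exI[of _ Z]) (use that in \<open>auto simp: star_def atom_act_def Fix_def image_def\<close>)
  then show ?thesis
    by (auto simp: invariant_set_def perm_set_iff fin_pow_def star_def atom_act_def image_image)
qed

end

theory Submission
  imports Defs
begin

text \<open>
  If an injective \<open>f\<close> misses \<open>x\<close>, then the points \<open>x, f x, f (f x), \<dots>\<close> are distinct and are all
  supported by the union of the supports of \<open>f\<close> and \<open>x\<close>. A surjective \<open>f\<close> makes the preimage map an
  injection of the finitely supported power set; this map is therefore onto, so a singleton \<open>{a}\<close> is
  a preimage under \<open>f\<close>, which separates \<open>a\<close> from all other points.

  Let \<open>S\<close> support a surjection \<open>f\<close> on the finite sets of atoms. By symmetry \<open>f Z - S\<close> is either
  empty or \<open>Z - S\<close>. Hence \<open>f\<close> maps each of the finite classes \<open>{Z. Z - S = Q}\<close> onto itself, first for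
  \<open>Q \<noteq> {}\<close> and then also for \<open>Q = {}\<close>, and is thus injective. On the other hand, the sets of all
  \<open>n\<close>-element sets of atoms, for varying \<open>n\<close>, have empty support.
\<close>

section \<open>Equivariance of finitely supported functions\<close>

lemma Fix_Un: "Fix (S \<union> T) = Fix S \<inter> Fix T"
  by (auto simp: Fix_def)

lemma Fix_inverse_obtain:
  assumes "\<pi> \<in> Fix S"
  obtains \<rho> where "\<rho> \<in> Fix S" "\<rho> \<circ> \<pi> = id" "\<pi> \<circ> \<rho> = id"
proof -
  obtain \<rho> where \<rho>: "permutation \<rho>" "\<rho> \<circ> \<pi> = id" "\<pi> \<circ> \<rho> = id"
    using assms by (auto simp: Fix_def elim: permutation_inverse_obtain)
  moreover have "\<rho> a = a" if "a \<in> S" for a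
    using that assms fun_cong[OF \<rho>(2), of a] by (auto simp: Fix_def)
  ultimately show ?thesis using that by (auto simp: Fix_def)
qed

lemma perm_set_cancel:
  assumes "perm_set Y act" "permutation \<pi>" "permutation \<sigma>" "\<pi> \<circ> \<sigma> = id" "y \<in> Y"
  shows "act \<pi> (act \<sigma> y) = y"
  using assms unfolding perm_set_iff by metis

text \<open>If \<open>\<pi>\<close> preserves the graph, then
  \<open>(actX \<pi> x, actY \<pi> (f x))\<close> is again a point of it: its first component lies
  in \<open>Z\<close>, and its second is the value of \<open>f\<close> there.\<close>

lemma fs_fun_equivariant_obtain:
  assumes "fs_fun actX actY Z T f"
  obtains S where "finite S"
    and "\<And>\<pi> x. \<pi> \<in> Fix S \<Longrightarrow> x \<in> Z \<Longrightarrow> actX \<pi> x \<in> Z"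
    and "\<And>\<pi> x. \<pi> \<in> Fix S \<Longrightarrow> x \<in> Z \<Longrightarrow> f (actX \<pi> x) = actY \<pi> (f x)"
proof -
  let ?G = "(\<lambda>x. (x, f x)) ` Z"
  obtain S where S: "finite S" "\<And>\<pi>. \<pi> \<in> Fix S \<Longrightarrow> map_prod (actX \<pi>) (actY \<pi>) ` ?G = ?G"
    using assms
    by (auto simp: fs_fun_def finitely_supported_def supports_def star_def prod_act_def)
  have "actX \<pi> x \<in> Z \<and> f (actX \<pi> x) = actY \<pi> (f x)" if "\<pi> \<in> Fix S" "x \<in> Z" for \<pi> x
    using S(2)[OF that(1)] that(2) by force
  with S(1) show thesis by (intro that[of S]) simp_all
qed

lemma fs_funI:
  assumes act: "perm_set Y actX" "perm_set V actY" "Z \<subseteq> Y" "T \<subseteq> V"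
    and f: "f \<in> Z \<rightarrow> T" and S: "finite S"
    and eq: "\<And>\<pi> x. \<pi> \<in> Fix S \<Longrightarrow> x \<in> Z \<Longrightarrow> actX \<pi> x \<in> Z"
      "\<And>\<pi> x. \<pi> \<in> Fix S \<Longrightarrow> x \<in> Z \<Longrightarrow> f (actX \<pi> x) = actY \<pi> (f x)"
  shows "fs_fun actX actY Z T f"
proof -
  let ?G = "(\<lambda>x. (x, f x)) ` Z"
  have "map_prod (actX \<pi>) (actY \<pi>) ` ?G = ?G" if \<pi>: "\<pi> \<in> Fix S" for \<pi>
  proof
    show "map_prod (actX \<pi>) (actY \<pi>) ` ?G \<subseteq> ?G" using eq[OF \<pi>] by force
    \<comment> \<open>Equivariance under \<open>\<pi>\<close> only maps the graph into itself;
      equivariance under the inverse supplies the preimage of each point.\<close>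
    obtain \<rho> where \<rho>: "\<rho> \<in> Fix S" "\<pi> \<circ> \<rho> = id" using \<pi> by (rule Fix_inverse_obtain)
    show "?G \<subseteq> map_prod (actX \<pi>) (actY \<pi>) ` ?G"
    proof clarify
      fix x assume x: "x \<in> Z"
      have "actX \<pi> (actX \<rho> x) = x"
        by (rule perm_set_cancel[OF act(1)]) (use \<pi> \<rho> x act in \<open>auto simp: Fix_def\<close>)
      then have "(x, f x) = map_prod (actX \<pi>) (actY \<pi>) (actX \<rho> x, f (actX \<rho> x))"
        using eq(2)[OF \<pi> eq(1)[OF \<rho>(1) x]] by simp
      then show "(x, f x) \<in> map_prod (actX \<pi>) (actY \<pi>) ` ?G"
        using eq(1)[OF \<rho>(1) x] by blast
    qed
  qed
  then show ?thesis
    using f S unfolding fs_fun_def finitely_supported_def supports_def star_def prod_act_def by blast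
qed

section \<open>Injective self-maps\<close>

text \<open>Cancelling \<open>f\<close> from an equality of two iterates would leave
  \<open>x\<close> equal to a proper iterate, which lies in the image of \<open>f\<close>.\<close>

lemma funpow_distinct_if_not_in_image:
  assumes f: "f \<in> X \<rightarrow> X" "inj_on f X" and x: "x \<in> X" "x \<notin> f ` X"
  shows "inj (\<lambda>n. (f ^^ n) x)"
proof (rule linorder_injI)
  have mem: "(f ^^ n) x \<in> X" for n using f(1) x(1) by (induction n) auto
  fix m n :: nat
  show "m < n \<Longrightarrow> (f ^^ m) x \<noteq> (f ^^ n) x"
  proof (induction m arbitrary: n)
    case 0
    then obtain k where "n = Suc k" by (cases n) auto
    then show ?case using x(2) mem[of k] by auto
  next
    case (Suc m)
    then obtain k where "n = Suc k" "m < k" by (cases n) auto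
    then show ?case using Suc.IH inj_onD[OF f(2) _ mem mem] by fastforce
  qed
qed

text \<open>Only pointwise finite support is assumed, so that the lemma serves both \<open>X\<close>
  with \<open>act\<close> and \<open>fs_pow act X\<close> with \<open>star act\<close>.\<close>

lemma fs_inj_imp_surj:
  assumes fs: "\<And>x. x \<in> X \<Longrightarrow> finitely_supported act x"
    and X: "\<not> uniformly_infinite act X"
    and f: "fs_fun act act X X f" "inj_on f X"
  shows "f ` X = X"
proof (rule ccontr)
  assume "f ` X \<noteq> X"
  have fX: "f \<in> X \<rightarrow> X" using f(1) by (simp add: fs_fun_def)
  then obtain x where x: "x \<in> X" "x \<notin> f ` X" using \<open>f ` X \<noteq> X\<close> by blast
  obtain S where S: "finite S" and "\<And>\<pi> x. \<pi> \<in> Fix S \<Longrightarrow> x \<in> X \<Longrightarrow> act \<pi> x \<in> X"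
    and eq: "\<And>\<pi> x. \<pi> \<in> Fix S \<Longrightarrow> x \<in> X \<Longrightarrow> f (act \<pi> x) = act \<pi> (f x)"
    using fs_fun_equivariant_obtain[OF f(1)] by blast
  obtain T where T: "finite T" "supports act T x"
    using fs[OF x(1)] by (auto simp: finitely_supported_def)
  let ?Z = "range (\<lambda>n. (f ^^ n) x)"
  have mem: "(f ^^ n) x \<in> X" for n using fX x(1) by (induction n) auto
  \<comment> \<open>Once a support contains \<open>S\<close>, it passes from a point to its image
    under \<open>f\<close>; hence one set serves all iterates.\<close>
  have "supports act (S \<union> T) ((f ^^ n) x)" for n
  proof (induction n)
    case 0
    then show ?case using T(2) by (simp add: supports_def Fix_Un)
  next
    case (Suc n)
    then show ?case
      using eq[OF _ mem, of _ n, symmetric] by (auto simp: supports_def Fix_Un)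
  qed
  then have "uniformly_supported act ?Z"
    unfolding uniformly_supported_def using S T(1) by (intro exI[of _ "S \<union> T"]) auto
  moreover have "infinite ?Z"
    using funpow_distinct_if_not_in_image[OF fX f(2) x] by (simp add: finite_image_iff)
  ultimately have "uniformly_infinite act X"
    unfolding uniformly_infinite_def using mem by (intro exI[of _ ?Z]) auto
  then show False using X by simp
qed

section \<open>Preimage maps and surjective self-maps\<close>

text \<open>Taking preimages commutes with every permutation with which \<open>f\<close> commutes,
  so a support of \<open>f\<close> also supports the preimage map.\<close>

lemma fs_fun_vimage:
  assumes Y: "invariant_set Y act" and X: "X \<in> fs_pow act Y" and f: "fs_fun act act X X f"
  shows "fs_fun (star act) (star act) (fs_pow act X) (fs_pow act X) (\<lambda>W. f -` W \<inter> X)"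
proof -
  let ?g = "\<lambda>W. f -` W \<inter> X"
  obtain S where S: "finite S"
    "\<And>\<pi> x. \<pi> \<in> Fix S \<Longrightarrow> x \<in> X \<Longrightarrow> act \<pi> x \<in> X"
    "\<And>\<pi> x. \<pi> \<in> Fix S \<Longrightarrow> x \<in> X \<Longrightarrow> f (act \<pi> x) = act \<pi> (f x)"
    using fs_fun_equivariant_obtain[OF f] by blast
  have p: "perm_set Y act" using Y by (simp add: invariant_set_def)
  have XY: "X \<subseteq> Y" using X by (simp add: fs_pow_def)
  have cancel: "act \<pi> (act \<rho> x) = x"
    if "\<pi> \<in> Fix S" "\<rho> \<in> Fix S" "\<pi> \<circ> \<rho> = id" "x \<in> X" for \<pi> \<rho> x
    by (rule perm_set_cancel[OF p]) (use that XY in \<open>auto simp: Fix_def\<close>)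
  have eq: "?g (star act \<pi> W) = star act \<pi> (?g W)" if \<pi>: "\<pi> \<in> Fix S" and W: "W \<subseteq> X" for \<pi> W
  proof
    show "star act \<pi> (?g W) \<subseteq> ?g (star act \<pi> W)"
      using S(2,3)[OF \<pi>] by (auto simp: star_def)
    obtain \<rho> where \<rho>: "\<rho> \<in> Fix S" "\<rho> \<circ> \<pi> = id" "\<pi> \<circ> \<rho> = id"
      using \<pi> by (rule Fix_inverse_obtain)
    show "?g (star act \<pi> W) \<subseteq> star act \<pi> (?g W)"
    proof
      fix y assume "y \<in> ?g (star act \<pi> W)"
      then obtain w where y: "y \<in> X" and w: "f y = act \<pi> w" "w \<in> W"
        by (auto simp: star_def)
      have "f (act \<rho> y) = w"
        using S(3)[OF \<rho>(1) y] w W cancel[OF \<rho>(1) \<pi> \<rho>(2)] by auto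
      then have "act \<rho> y \<in> ?g W" using S(2)[OF \<rho>(1) y] w by simp
      then show "y \<in> star act \<pi> (?g W)"
        using cancel[OF \<pi> \<rho>(1,3) y] unfolding star_def by (metis image_eqI)
    qed
  qed
  have closed: "star act \<pi> W \<in> fs_pow act X" if "\<pi> \<in> Fix S" "W \<in> fs_pow act X" for \<pi> W
    using finitely_supported_act[OF perm_set_Pow[OF p], of W \<pi>] that S(2) XY
    by (auto simp: fs_pow_def Fix_def star_def)
  have "?g W \<in> fs_pow act X" if W: "W \<in> fs_pow act X" for W
  proof -
    obtain T where T: "finite T" "supports (star act) T W"
      using W by (auto simp: fs_pow_def finitely_supported_def)
    \<comment> \<open>Fixing \<open>S\<close> lets \<open>\<pi>\<close> pass through the preimage;
      fixing \<open>T\<close> then leaves \<open>W\<close> unchanged.\<close>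
    have "supports (star act) (S \<union> T) (?g W)"
      unfolding supports_def Fix_Un
    proof
      fix \<pi> assume \<pi>: "\<pi> \<in> Fix S \<inter> Fix T"
      then have "star act \<pi> (?g W) = ?g (star act \<pi> W)"
        using eq[of \<pi> W] W by (simp add: fs_pow_def)
      also have "star act \<pi> W = W" using T(2) \<pi> by (simp add: supports_def)
      finally show "star act \<pi> (?g W) = ?g W" .
    qed
    then show ?thesis
      using S(1) T(1) unfolding fs_pow_def finitely_supported_def by blast
  qed
  then have g: "?g \<in> fs_pow act X \<rightarrow> fs_pow act X" by blast
  have sub: "fs_pow act X \<subseteq> Pow Y" using XY by (auto simp: fs_pow_def)
  show ?thesis
    by (rule fs_funI[OF perm_set_Pow[OF p] perm_set_Pow[OF p] sub sub g S(1) closed])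
      (use eq in \<open>auto simp: fs_pow_def\<close>)
qed

lemma fs_surj_imp_inj:
  assumes Y: "invariant_set Y act" and X: "X \<in> fs_pow act Y"
    and ninf: "\<not> uniformly_infinite (star act) (fs_pow act X)"
    and f: "fs_fun act act X X f" "f ` X = X"
  shows "inj_on f X"
proof (rule inj_onI)
  let ?g = "\<lambda>W. f -` W \<inter> X"
  fix a b assume ab: "a \<in> X" "b \<in> X" "f a = f b"
  have "inj_on ?g (fs_pow act X)"
  proof (rule inj_onI)
    fix V W assume "V \<in> fs_pow act X" "W \<in> fs_pow act X" "?g V = ?g W"
    \<comment> \<open>Since \<open>f\<close> is onto, taking images undoes taking preimages, which
      makes \<open>?g\<close> injective.\<close>
    moreover have "f ` ?g U = U" if "U \<in> fs_pow act X" for U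
    proof -
      have "U \<subseteq> f ` X" using that f(2) by (simp add: fs_pow_def)
      then show ?thesis by blast
    qed
    ultimately show "V = W" by metis
  qed
  then have "?g ` fs_pow act X = fs_pow act X"
    using ninf fs_fun_vimage[OF Y X f(1)]
    by (intro fs_inj_imp_surj[of _ "star act"]) (auto simp: fs_pow_def)
  moreover have "{a} \<in> fs_pow act X"
    using Y X ab(1)
    by (force simp: invariant_set_def fs_pow_def finitely_supported_def supports_def star_def)
  ultimately obtain W where W: "{a} = ?g W" by blast
  then have "f a \<in> W" by blast
  then have "b \<in> ?g W" using ab by simp
  then show "a = b" unfolding W[symmetric] by simp
qed

section \<open>Finite sets of atoms\<close>

text \<open>Two atoms outside \<open>S\<close>, both in \<open>Z\<close> or both outside it, are
  swapped by a transposition that preserves \<open>Z\<close> and hence \<open>f Z\<close>. So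
  \<open>f Z\<close> contains all or none of \<open>Z - S\<close>, and likewise of the atoms outside
  \<open>S \<union> Z\<close>; finiteness excludes all of the latter.\<close>

lemma fs_fun_fin_pow_diff:
  fixes f :: "'a::infinite set \<Rightarrow> 'a set"
  assumes S: "finite S"
    and eq: "\<And>\<pi> Z. \<pi> \<in> Fix S \<Longrightarrow> finite Z \<Longrightarrow> f (\<pi> ` Z) = \<pi> ` f Z"
    and Z: "finite Z" "finite (f Z)"
  shows "f Z - S = {} \<or> f Z - S = Z - S"
proof -
  have swap: "d \<in> f Z"
    if c: "c \<in> f Z" "c \<notin> S" and d: "d \<notin> S" "c \<in> Z \<longleftrightarrow> d \<in> Z" for c d
  proof -
    have "transpose c d \<in> Fix S"
      using c d by (auto simp: Fix_def transpose_def permutation_swap_id)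
    moreover have "transpose c d ` Z = Z" using d(2) by (rule transpose_image_eq)
    ultimately have "transpose c d ` f Z = f Z" using eq[of "transpose c d" Z] Z(1) by simp
    then show ?thesis using c(1) by (metis image_eqI transpose_apply_first)
  qed
  have "c \<in> Z" if c: "c \<in> f Z" "c \<notin> S" for c
  proof (rule ccontr)
    assume "c \<notin> Z"
    \<comment> \<open>A fresh atom \<open>d\<close> could be swapped with \<open>c\<close>, forcing
      \<open>d\<close> into \<open>f Z\<close>.\<close>
    obtain d where "d \<notin> S \<union> Z \<union> f Z"
      using ex_new_if_finite[OF infinite_UNIV, of "S \<union> Z \<union> f Z"] S Z by auto
    then show False using swap[OF c, of d] \<open>c \<notin> Z\<close> by blast
  qed
  then show ?thesis using swap by blast
qed

lemma fin_pow_surj_imp_inj: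
  fixes f :: "'a::infinite set \<Rightarrow> 'a set"
  assumes f: "fs_fun (star atom_act) (star atom_act) fin_pow fin_pow f" "f ` fin_pow = fin_pow"
  shows "inj_on f fin_pow"
proof -
  obtain S where S: "finite S"
    "\<And>\<pi> Z. \<pi> \<in> Fix S \<Longrightarrow> finite Z \<Longrightarrow> f (\<pi> ` Z) = \<pi> ` f Z"
    using fs_fun_equivariant_obtain[OF f(1)]
    unfolding star_def atom_act_def fin_pow_def mem_Collect_eq by metis
  have fin: "finite (f Z)" if "finite Z" for Z
    using f(2) that by (auto simp: fin_pow_def)
  have diff: "f Z - S = {} \<or> f Z - S = Z - S" if "finite Z" for Z
    using fs_fun_fin_pow_diff[of S f, OF S that fin[OF that]] .
  \<comment> \<open>A member of \<open>L Q\<close> is determined by its intersection with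
    \<open>S\<close>, so each class is finite.\<close>
  define L where "L Q = {Z. Z - S = Q}" for Q
  have finL: "finite (L Q)" for Q
  proof (rule finite_subset)
    show "L Q \<subseteq> (\<lambda>P. P \<union> Q) ` Pow S"
    proof
      fix Z assume "Z \<in> L Q"
      then have "Z = (Z \<inter> S) \<union> Q" by (auto simp: L_def)
      then show "Z \<in> (\<lambda>P. P \<union> Q) ` Pow S" by blast
    qed
  qed (use S(1) in simp)
  have pre: "\<exists>X. finite X \<and> f X = Z" if "Z \<in> L Q" "finite Q" for Z Q
  proof -
    have "finite Z" using that S(1) by (metis (mono_tags) L_def finite_Diff2 mem_Collect_eq)
    then have "Z \<in> f ` fin_pow" using f(2) by (simp add: fin_pow_def)
    then show ?thesis by (auto simp: fin_pow_def)
  qed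
  \<comment> \<open>By counting, a finite class covered by its own image equals that image, and
    \<open>f\<close> is injective on it.\<close>
  have onto: "f ` L Q = L Q \<and> inj_on f (L Q)" if "L Q \<subseteq> f ` L Q" for Q
    using card_seteq[OF finite_imageI[OF finL] that card_image_le[OF finL]]
      finite_surj_inj[OF finL that] by simp
  have bij1: "f ` L Q = L Q \<and> inj_on f (L Q)" if Q: "finite Q" "Q \<noteq> {}" for Q
  proof (rule onto, rule subsetI)
    fix Z assume Z: "Z \<in> L Q"
    then obtain X where X: "finite X" "f X = Z" using pre Q(1) by blast
    \<comment> \<open>As \<open>Z - S = Q\<close> is nonempty, the empty alternative in
      \<open>diff\<close> is excluded for \<open>X\<close>.\<close>
    then have "X \<in> L Q" using diff[OF X(1)] Z Q(2) by (auto simp: L_def)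
    then show "Z \<in> f ` L Q" using X(2) by blast
  qed
  have bij0: "f ` L {} = L {} \<and> inj_on f (L {})"
  proof (rule onto, rule subsetI)
    fix Z assume Z: "Z \<in> L {}"
    then obtain X where X: "finite X" "f X = Z" using pre by blast
    \<comment> \<open>Otherwise \<open>X\<close> lies in a class already known to be mapped onto
      itself, and its image \<open>Z\<close> could not lie in \<open>L {}\<close>.\<close>
    have "X - S = {}"
    proof (rule ccontr)
      assume "X - S \<noteq> {}"
      then have "f ` L (X - S) = L (X - S)" using bij1 X(1) by blast
      moreover have "X \<in> L (X - S)" by (simp add: L_def)
      ultimately have "Z \<in> L (X - S)" using X(2) by blast
      then show False using Z \<open>X - S \<noteq> {}\<close> unfolding L_def by blast
    qed
    then show "Z \<in> f ` L {}" using X(2) by (auto simp: L_def)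
  qed
  have bij: "f ` L Q = L Q \<and> inj_on f (L Q)" if "finite Q" for Q
    using bij0 bij1[OF that] by (cases "Q = {}") auto
  \<comment> \<open>Thus sets with the same value lie in one class, where \<open>f\<close> is
    injective.\<close>
  have level: "f Z \<in> L (Z - S)" if "finite Z" for Z
    using bij[of "Z - S"] that by (auto simp: L_def)
  show ?thesis
  proof (rule inj_onI)
    fix V W assume "V \<in> fin_pow" "W \<in> fin_pow" and eq: "f V = f W"
    then have VW: "finite V" "finite W" by (auto simp: fin_pow_def)
    then have "V - S = W - S" using level[of V] level[of W] eq by (simp add: L_def)
    then have "V \<in> L (V - S)" "W \<in> L (V - S)" by (auto simp: L_def)
    then show "V = W" using bij[of "V - S"] VW(1) eq by (auto dest: inj_onD)
  qed
qed

text \<open>Together with \<open>fin_pow_surj_imp_inj\<close>, this refutes the converse of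
  \<open>fs_surj_imp_inj\<close>.\<close>

lemma uniformly_infinite_fs_pow_fin_pow:
  "uniformly_infinite (star (star atom_act)) (fs_pow (star atom_act) (fin_pow :: 'a::infinite set set))"
proof -
  define C :: "nat \<Rightarrow> 'a set set" where "C n = {Z. finite Z \<and> card Z = n}" for n
  have "inj C"
  proof (rule injI)
    fix m n assume "C m = C n"
    \<comment> \<open>Infinitely many atoms give a set of every finite size; so no
      \<open>C m\<close> is empty, and a member reveals \<open>m\<close>.\<close>
    moreover obtain Z :: "'a set" where "finite Z" "card Z = m"
      using infinite_arbitrarily_large[OF infinite_UNIV] by blast
    then have "Z \<in> C m" by (simp add: C_def)
    ultimately show "m = n" by (auto simp: C_def)
  qed
  have sub: "star (star atom_act) \<pi> (C n) \<subseteq> C n" if "permutation \<pi>" for \<pi> n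
    using card_image[OF inj_on_subset[OF bij_is_inj[OF permutation_bijective[OF that]]]]
    by (auto simp: star_def atom_act_def C_def)
  have supp: "supports (star (star atom_act)) {} (C n)" for n
    unfolding supports_def
  proof
    fix \<pi> :: "'a \<Rightarrow> 'a" assume "\<pi> \<in> Fix {}"
    then have \<pi>: "permutation \<pi>" by (simp add: Fix_def)
    then obtain \<rho> where \<rho>: "permutation \<rho>" "\<pi> \<circ> \<rho> = id" by (rule permutation_inverse_obtain)
    \<comment> \<open>Applying \<open>sub\<close> to the inverse permutation gives the reverse
      inclusion.\<close>
    have "Z \<in> star (star atom_act) \<pi> (C n)" if Z: "Z \<in> C n" for Z
    proof -
      have "\<rho> ` Z \<in> C n" using sub[OF \<rho>(1), of n] Z by (auto simp: star_def atom_act_def)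
      moreover have "Z = \<pi> ` \<rho> ` Z" using \<rho>(2) by (simp add: image_comp)
      ultimately show ?thesis unfolding star_def atom_act_def by blast
    qed
    then show "star (star atom_act) \<pi> (C n) = C n" using sub[OF \<pi>, of n] by blast
  qed
  have "range C \<subseteq> fs_pow (star atom_act) fin_pow"
    using supp by (auto simp: fs_pow_def finitely_supported_def fin_pow_def C_def)
  moreover have "uniformly_supported (star (star atom_act)) (range C)"
    using supp unfolding uniformly_supported_def by blast
  ultimately show ?thesis
    unfolding uniformly_infinite_def using \<open>inj C\<close>
    by (intro exI[of _ "range C"]) (simp add: finite_image_iff)
qed

theorem theorem3p10:
  shows
   "(\<forall>(act :: ('a::infinite \<Rightarrow> 'a) \<Rightarrow> 'x \<Rightarrow> 'x) Y X.
       invariant_set Y act \<and> X \<in> fs_pow act Y \<longrightarrow>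
         (\<not> uniformly_infinite act X \<longrightarrow>
            (\<forall>f. fs_fun act act X X f \<and> inj_on f X \<longrightarrow> f ` X = X)) \<and>
         (\<not> uniformly_infinite (star act) (fs_pow act X) \<longrightarrow>
            (\<forall>f. fs_fun act act X X f \<and> f ` X = X \<longrightarrow> inj_on f X))) \<and>
    (\<forall>f :: 'a set \<Rightarrow> 'a set.
       fs_fun (star atom_act) (star atom_act) fin_pow fin_pow f \<and> f ` fin_pow = fin_pow \<longrightarrow>
         inj_on f fin_pow) \<and>
    uniformly_infinite (star (star atom_act)) (fs_pow (star atom_act) (fin_pow :: 'a set set))"
proof (intro conjI allI impI; (elim conjE)?)
  fix act :: "('a \<Rightarrow> 'a) \<Rightarrow> 'x \<Rightarrow> 'x" and Y X f
  assume Y: "invariant_set Y act" "X \<in> fs_pow act Y"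
  have fs: "finitely_supported act x" if "x \<in> X" for x
    using Y that by (auto simp: invariant_set_def fs_pow_def)
  show "f ` X = X"
    if "\<not> uniformly_infinite act X" "fs_fun act act X X f" "inj_on f X"
    using fs that by (rule fs_inj_imp_surj)
  show "inj_on f X"
    if "\<not> uniformly_infinite (star act) (fs_pow act X)" "fs_fun act act X X f" "f ` X = X"
    using Y that by (rule fs_surj_imp_inj)
next
  fix f :: "'a set \<Rightarrow> 'a set"
  assume "fs_fun (star atom_act) (star atom_act) fin_pow fin_pow f" "f ` fin_pow = fin_pow"
  then show "inj_on f fin_pow" by (rule fin_pow_surj_imp_inj)
next
  show "uniformly_infinite (star (star atom_act)) (fs_pow (star atom_act) (fin_pow :: 'a set set))"
    by (rule uniformly_infinite_fs_pow_fin_pow)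
qed

end
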